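(* For every $n\in\mathbb{N}$, \[ N_{(1,3)}(n)=8\sigma(n)-32\sigma(\tfrac n4)+8\sigma(\tfrac n3)-32\sigma(\tfrac n{12})+64W_{(1,3)}(n)+1024W_{(1,3)}(\tfrac n4)-256\bigl(W_{(3,4)}(n)+W_{(1,12)}(n)\bigr). \]
   Context: $\sigma_k(n)=\sum_{d\mid n}d^k$ for $n\in\mathbb{N}$, $\sigma_k(x)=0$ for $x\notin\mathbb{N}$, $\sigma=\sigma_1$. $W_{(\alpha,\beta)}(n)=\sum_{(l,m)\in\mathbb{N}_0^2,\ \alpha l+\beta m=n}\sigma(l)\sigma(m)$, and $W_{(\alpha,\beta)}(x)=0$ if $x\notin\mathbb{N}$. For $a,b\in\mathbb{N}$, $N_{(a,b)}(n)$ is the number of $(x_1,\dots,x_8)\in\mathbb{Z}^8$ with $n=a(x_1^2+x_2^2+x_3^2+x_4^2)+b(x_5^2+x_6^2+x_7^2+x_8^2)$. *)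

theory Defs
  imports "HOL-Number_Theory.Number_Theory"
begin

definition sigma_k :: "nat \<Rightarrow> nat \<Rightarrow> int" where
  "sigma_k k n = (\<Sum>d \<in> {d. d dvd n}. int d ^ k)"

definition sigma :: "rat \<Rightarrow> int" where
  "sigma x = (if x \<in> \<int> \<and> x > 0 then sigma_k 1 (nat \<lfloor>x\<rfloor>) else 0)"

definition W :: "nat \<Rightarrow> nat \<Rightarrow> rat \<Rightarrow> int" where
  "W al be x = (if x \<in> \<int> \<and> x > 0 then
     (\<Sum>(l, m) \<in> {p :: nat \<times> nat. al * fst p + be * snd p = nat \<lfloor>x\<rfloor>}.
        sigma (of_nat l) * sigma (of_nat m))
   else 0)"

text \<open>N_(a,b)(n): number of x in Z^8 with n = a(x1^2+..+x4^2) + b(x5^2+..+x8^2).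
  Vectors in Z^8 are represented as functions nat => int supported on {0..<8}.\<close>
definition N :: "nat \<Rightarrow> nat \<Rightarrow> nat \<Rightarrow> nat" where
  "N a b n = card {x :: nat \<Rightarrow> int. (\<forall>i \<ge> 8. x i = 0) \<and>
     int n = int a * (\<Sum>i<4. (x i)\<^sup>2) + int b * (\<Sum>i\<in>{4..<8}. (x i)\<^sup>2)}"

end

theory Submission
  imports Defs
begin

text \<open>
  Jacobi's four-square theorem \<open>r\<^sub>4(n) = 8 \<sigma>(n) - 32 \<sigma>(n/4)\<close> for \<open>n \<ge> 1\<close> turns \<open>N\<close> into a
  convolution, and expanding the product gives the formula. Jacobi's theorem itself follows from the
  recurrence \<open>\<Sum>\<^sub>k (n - 5k\<^sup>2) r\<^sub>4(n - k\<^sup>2) = 0\<close>, which determines \<open>r\<^sub>4\<close> from \<open>r\<^sub>4(0) = 1\<close>. The function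
  \<open>r\<^sub>4\<close> satisfies it because the five coordinates play symmetric roles in \<open>k\<^sup>2 + a\<^sup>2 + b\<^sup>2 + c\<^sup>2 + d\<^sup>2 = n\<close>.
  For the divisor sum it reduces to evaluating \<open>G(M) = \<Sum> d (M - 5i\<^sup>2)\<close> over \<open>i\<^sup>2 + 4de = M\<close> with
  \<open>d, e > 0\<close>: in the coordinates \<open>x = e - i\<close>, \<open>y = 2d + i\<close>, \<open>z = 2d + i - e\<close> the constraint
  becomes \<open>x\<^sup>2 + y\<^sup>2 - z\<^sup>2 = M\<close> and \<open>G(M)\<close> is twice the sum of the odd function \<open>xyz\<close> over a half
  cone, so that sign changes cancel everything but boundary terms, which occur only for square \<open>M\<close>
  and give \<open>M (M - 1) / 3\<close>.
\<close>

section \<open>Weighted sums over the solutions of \<open>i\<^sup>2 + c * d * e = M\<close>\<close>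

lemma sum_neg_self_0:
  fixes f :: "'a \<Rightarrow> int"
  assumes "bij_betw h A A" and "\<And>x. x \<in> A \<Longrightarrow> f (h x) = - f x"
  shows "sum f A = 0"
proof -
  have "sum f A = (\<Sum>x\<in>A. f (h x))"
    using sum.reindex_bij_betw[OF assms(1), of f] by simp
  also have "\<dots> = - sum f A"
    using assms(2) by (simp add: sum_negf)
  finally show ?thesis by simp
qed

lemma abs_le_square: "\<bar>x\<bar> \<le> x\<^sup>2" for x :: int
proof -
  have "\<bar>x\<bar> * 1 \<le> \<bar>x\<bar> * \<bar>x\<bar>" if "x \<noteq> 0"
    using that by (intro mult_left_mono) auto
  then show ?thesis by (cases "x = 0") (auto simp: power2_eq_square)
qed

text \<open>The coefficient \<open>c\<close> stays a parameter because the two divisor sums in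
  Jacobi's formula lead to \<open>c = 1\<close> and \<open>c = 4\<close>.\<close>

definition triples :: "int \<Rightarrow> int \<Rightarrow> (int \<times> int \<times> int) set" where
  "triples c M = {(i, d, e). d > 0 \<and> e > 0 \<and> i\<^sup>2 + c * d * e = M}"

lemma triples_bounds:
  assumes "(i, d, e) \<in> triples c M" "c > 0"
  shows "\<bar>i\<bar> \<le> M" "1 \<le> d" "d \<le> M" "1 \<le> e" "e \<le> M"
proof -
  have p: "d > 0" "e > 0" "i\<^sup>2 + c * d * e = M" using assms by (auto simp: triples_def)
  have "d * 1 \<le> d * (c * e)" "e * 1 \<le> e * (c * d)"
    using p assms(2) by (intro mult_left_mono; simp add: int_one_le_iff_zero_less)+
  then have l: "d \<le> c * d * e" "e \<le> c * d * e" by (simp_all add: ac_simps)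
  show "\<bar>i\<bar> \<le> M" "1 \<le> d" "d \<le> M" "1 \<le> e" "e \<le> M"
    using l p abs_le_square[of i] zero_le_power2[of i] by linarith+
qed

lemma finite_triples: "c > 0 \<Longrightarrow> finite (triples c M)"
proof (rule finite_subset)
  assume "c > 0"
  show "triples c M \<subseteq> {-M..M} \<times> {1..M} \<times> {1..M}"
  proof
    fix t assume "t \<in> triples c M"
    then obtain i d e where "t = (i, d, e)" "(i, d, e) \<in> triples c M" by (cases t) auto
    then show "t \<in> {-M..M} \<times> {1..M} \<times> {1..M}"
      using triples_bounds[of i d e c M] \<open>c > 0\<close> by auto
  qed
qed simp

lemma sum_triples_neg:
  "(\<Sum>(i, d, e)\<in>triples c M. f (-i) d e) = (\<Sum>(i, d, e)\<in>triples c M. f i d e :: int)"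
  by (rule sum.reindex_bij_witness[of _ "\<lambda>(i, d, e). (-i, d, e)" "\<lambda>(i, d, e). (-i, d, e)"])
     (auto simp: triples_def)

lemma sum_triples_swap:
  "(\<Sum>(i, d, e)\<in>triples c M. f i e d) = (\<Sum>(i, d, e)\<in>triples c M. f i d e :: int)"
  by (rule sum.reindex_bij_witness[of _ "\<lambda>(i, d, e). (i, e, d)" "\<lambda>(i, d, e). (i, e, d)"])
     (auto simp: triples_def ac_simps)

section \<open>The indefinite form \<open>x\<^sup>2 + y\<^sup>2 - z\<^sup>2\<close> and its
  symmetries\<close>

definition lorentz :: "int \<Rightarrow> (int \<times> int \<times> int) set" where
  "lorentz M = {(x, y, z). even (x + z) \<and> x\<^sup>2 + y\<^sup>2 - z\<^sup>2 = M}"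

text \<open>Under this substitution \<open>x + z = 2 * d\<close> and \<open>y - z = e\<close>, so
  positivity of \<open>d\<close> and \<open>e\<close> becomes the two strict inequalities. The
  parity condition in \<open>lorentz\<close> is what makes \<open>d\<close> an integer.\<close>

lemma bij_betw_triples_lorentz:
  "bij_betw (\<lambda>(i, d, e). (e - i, 2 * d + i, 2 * d + i - e)) (triples 4 M)
     {(x, y, z)\<in>lorentz M. x + z > 0 \<and> y > z}"
proof (rule bij_betw_byWitness[where f' = "\<lambda>(x, y, z). (y - x - z, (x + z) div 2, y - z)"])
  show "(\<lambda>(i, d, e). (e - i, 2 * d + i, 2 * d + i - e)) ` triples 4 M
      \<subseteq> {(x, y, z)\<in>lorentz M. x + z > 0 \<and> y > z}"
  proof clarify
    fix i d e assume a: "(i, d, e) \<in> triples 4 M"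
    then have "(e - i)\<^sup>2 + (2 * d + i)\<^sup>2 - (2 * d + i - e)\<^sup>2 = M"
      by (simp add: triples_def power2_eq_square algebra_simps)
    then show "(e - i, 2 * d + i, 2 * d + i - e) \<in> lorentz M
        \<and> 0 < e - i + (2 * d + i - e) \<and> 2 * d + i - e < 2 * d + i"
      using a by (auto simp: triples_def lorentz_def)
  qed
  show "(\<lambda>(x, y, z). (y - x - z, (x + z) div 2, y - z)) `
      {(x, y, z)\<in>lorentz M. x + z > 0 \<and> y > z} \<subseteq> triples 4 M"
  proof clarify
    fix x y z assume a: "(x, y, z) \<in> lorentz M" "0 < x + z" "z < y"
    then obtain d where d: "x + z = 2 * d"
      by (auto simp: lorentz_def simp del: even_add)
    then have x: "x = 2 * d - z" by simp
    have "(y - x - z)\<^sup>2 + 4 * d * (y - z) = M"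
      using a x by (simp add: lorentz_def power2_eq_square algebra_simps)
    then show "(y - x - z, (x + z) div 2, y - z) \<in> triples 4 M"
      using a d by (simp add: triples_def)
  qed
qed (auto simp: lorentz_def simp del: even_add)

text \<open>Averaging over the sign of \<open>i\<close> keeps the even part of
  \<open>x * y * z\<close>, namely \<open>2 * (2 * d - e) * (d * e - i\<^sup>2)\<close>. Exchanging
  \<open>d\<close> and \<open>e\<close> then merges its two pieces, and the constraint replaces
  \<open>4 * d * e\<close> by \<open>M - i\<^sup>2\<close>.\<close>

lemma sum_triples_cubic:
  "(\<Sum>(i, d, e)\<in>triples 4 M. d * (M - 5 * i\<^sup>2)) =
   2 * (\<Sum>(x, y, z)\<in>{(x, y, z)\<in>lorentz M. x + z > 0 \<and> y > z}. x * y * z)"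
proof -
  let ?F = "\<lambda>i d e :: int. (e - i) * (2 * d + i) * (2 * d + i - e)"
  let ?g = "\<lambda>i d e :: int. d * d * e - d * i\<^sup>2"
  let ?S = "\<lambda>f. (\<Sum>(i, d, e)\<in>triples 4 M. f i d e)"
  have "2 * ?S ?F = ?S ?F + ?S (\<lambda>i. ?F (-i))"
    using sum_triples_neg[of ?F] by simp
  also have "\<dots> = ?S (\<lambda>i d e. 8 * ?g i d e - 4 * ?g i e d)"
    by (simp add: sum.distrib[symmetric] case_prod_unfold)
       (intro sum.cong refl, simp add: power2_eq_square algebra_simps)
  also have "\<dots> = 8 * ?S ?g - 4 * ?S (\<lambda>i d e. ?g i e d)"
    by (simp add: case_prod_unfold sum_subtractf sum_distrib_left)
  also have "\<dots> = 4 * ?S ?g"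
    using sum_triples_swap[of ?g] by simp
  also have "\<dots> = ?S (\<lambda>i d e. d * (M - 5 * i\<^sup>2))"
    by (simp add: sum_distrib_left)
       (intro sum.cong refl, auto simp: triples_def power2_eq_square algebra_simps)
  finally have "?S (\<lambda>i d e. d * (M - 5 * i\<^sup>2)) = 2 * ?S ?F" ..
  also have "?S ?F = (\<Sum>(x, y, z)\<in>{(x, y, z)\<in>lorentz M. x + z > 0 \<and> y > z}. x * y * z)"
    by (subst sum.reindex_bij_betw[OF bij_betw_triples_lorentz[of M], symmetric])
       (simp add: case_prod_unfold)
  finally show ?thesis .
qed

text \<open>Here \<open>x\<^sup>2 - z\<^sup>2\<close> factors as
  \<open>(x - \<bar>z\<bar>) * (x + \<bar>z\<bar>)\<close> with first factor at least 1, so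
  \<open>M\<close> bounds all three coordinates.\<close>

lemma finite_lorentz_cone: "finite {(x, y, z)\<in>lorentz M. x > \<bar>z\<bar>}"
proof (rule finite_subset)
  show "{(x, y, z)\<in>lorentz M. x > \<bar>z\<bar>} \<subseteq> {-M..M} \<times> {-M..M} \<times> {-M..M}"
  proof
    fix t assume "t \<in> {(x, y, z)\<in>lorentz M. x > \<bar>z\<bar>}"
    then obtain x y z where t: "t = (x, y, z)" "(x, y, z) \<in> lorentz M" and a: "\<bar>z\<bar> < x"
      by auto
    then have q: "x\<^sup>2 + y\<^sup>2 - z\<^sup>2 = M" by (simp add: lorentz_def)
    have "1 * (x + \<bar>z\<bar>) \<le> (x - \<bar>z\<bar>) * (x + \<bar>z\<bar>)"
      using a by (intro mult_right_mono) auto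
    also have "\<dots> = x\<^sup>2 - z\<^sup>2" by (simp add: power2_eq_square algebra_simps)
    finally have l: "x + \<bar>z\<bar> \<le> x\<^sup>2 - z\<^sup>2" by simp
    show "t \<in> {-M..M} \<times> {-M..M} \<times> {-M..M}"
      using t(1) l q a abs_le_square[of y] zero_le_power2[of y] by auto
  qed
qed simp

text \<open>The reflection of \<open>y\<close> makes the sum over the whole cone
  \<open>x > \<bar>z\<bar>\<close> vanish. Reflecting \<open>y\<close> and \<open>z\<close> together
  preserves \<open>x * y * z\<close> and exchanges \<open>y > z\<close> with \<open>y < z\<close>,
  so these two regions contribute equally and only \<open>y = z\<close> is left to balance
  them.\<close>

lemma sum_lorentz_cone:
  "2 * (\<Sum>(x, y, z)\<in>{(x, y, z)\<in>lorentz M. x > \<bar>z\<bar> \<and> y > z}. x * y * z) =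
   - (\<Sum>(x, y, z)\<in>{(x, y, z)\<in>lorentz M. x > \<bar>z\<bar> \<and> y = z}. x * y * z)"
proof -
  let ?f = "\<lambda>(x, y, z). x * y * z :: int"
  let ?C = "{(x, y, z)\<in>lorentz M. x > \<bar>z\<bar>}"
  let ?A = "{(x, y, z)\<in>lorentz M. x > \<bar>z\<bar> \<and> y > z}"
  let ?B = "{(x, y, z)\<in>lorentz M. x > \<bar>z\<bar> \<and> y < z}"
  let ?E = "{(x, y, z)\<in>lorentz M. x > \<bar>z\<bar> \<and> y = z}"
  have fin: "finite ?A" "finite ?B" "finite ?E"
    by (rule finite_subset[OF _ finite_lorentz_cone[of M]]; auto)+
  have "sum ?f ?C = 0"
    by (rule sum_neg_self_0[of "\<lambda>(x, y, z). (x, -y, z)"],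
        rule bij_betw_byWitness[where f' = "\<lambda>(x, y, z). (x, -y, z)"])
       (auto simp: lorentz_def)
  moreover have "sum ?f ?A = sum ?f ?B"
    by (rule sum.reindex_bij_witness[of _ "\<lambda>(x, y, z). (x, -y, -z)" "\<lambda>(x, y, z). (x, -y, -z)"])
       (auto simp: lorentz_def)
  moreover have "sum ?f ?C = sum ?f (?A \<union> ?B \<union> ?E)"
    by (rule sum.cong) auto
  moreover have "sum ?f (?A \<union> ?B \<union> ?E) = sum ?f ?A + sum ?f ?B + sum ?f ?E"
    by (subst sum.union_disjoint; (use fin in auto)?)+
  ultimately show ?thesis by linarith
qed

text \<open>When \<open>x + z > 0\<close>, exactly one of \<open>z > \<bar>x\<bar>\<close>,
  \<open>x = z > 0\<close> and \<open>x > \<bar>z\<bar>\<close> holds. The first region is cancelled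
  by the reflection of \<open>x\<close>, which respects \<open>y > z\<close>; the third is reduced
  to its face \<open>y = z\<close> by \<open>sum_lorentz_cone\<close>.\<close>

lemma sum_lorentz_boundary:
  "(\<Sum>(i, d, e)\<in>triples 4 M. d * (M - 5 * i\<^sup>2)) =
   2 * (\<Sum>(x, y, z)\<in>{(x, y, z)\<in>lorentz M. x = z \<and> x > 0 \<and> y > z}. x * y * z)
   - (\<Sum>(x, y, z)\<in>{(x, y, z)\<in>lorentz M. x > \<bar>z\<bar> \<and> y = z}. x * y * z)"
proof -
  let ?f = "\<lambda>(x, y, z). x * y * z :: int"
  let ?P = "{(x, y, z)\<in>lorentz M. x + z > 0 \<and> y > z}"
  let ?A = "{(x, y, z)\<in>lorentz M. z > \<bar>x\<bar> \<and> y > z}"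
  let ?B = "{(x, y, z)\<in>lorentz M. x = z \<and> x > 0 \<and> y > z}"
  let ?D = "{(x, y, z)\<in>lorentz M. x > \<bar>z\<bar> \<and> y > z}"
  have finP: "finite ?P"
    using bij_betw_finite[OF bij_betw_triples_lorentz[of M]] by (simp add: finite_triples)
  have fin: "finite ?A" "finite ?B" "finite ?D"
    by (rule finite_subset[OF _ finP]; auto)+
  have "sum ?f ?A = 0"
    by (rule sum_neg_self_0[of "\<lambda>(x, y, z). (-x, y, z)"],
        rule bij_betw_byWitness[where f' = "\<lambda>(x, y, z). (-x, y, z)"])
       (auto simp: lorentz_def)
  moreover have "sum ?f ?P = sum ?f (?A \<union> ?B \<union> ?D)"
    by (rule sum.cong) auto
  moreover have "sum ?f (?A \<union> ?B \<union> ?D) = sum ?f ?A + sum ?f ?B + sum ?f ?D"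
    by (subst sum.union_disjoint; (use fin in auto)?)+
  ultimately show ?thesis
    using sum_lorentz_cone[of M] sum_triples_cubic[of M] by linarith
qed

section \<open>Evaluation of the boundary terms\<close>

lemma sum_int_atLeastAtMost:
  "2 * \<Sum>{1..int k} = int k * (int k + 1)"
  "6 * (\<Sum>u\<in>{1..int k}. u\<^sup>2) = int k * (int k + 1) * (2 * int k + 1)"
proof (induction k)
  case (Suc k)
  have "{1..int (Suc k)} = insert (int k + 1) {1..int k}" by auto
  with Suc show "2 * \<Sum>{1..int (Suc k)} = int (Suc k) * (int (Suc k) + 1)"
    "6 * (\<Sum>u\<in>{1..int (Suc k)}. u\<^sup>2) = int (Suc k) * (int (Suc k) + 1) * (2 * int (Suc k) + 1)"
    by (simp_all add: algebra_simps power2_eq_square)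
qed simp_all

text \<open>On the faces \<open>x = z\<close> and \<open>y = z\<close> the form collapses to
  \<open>y\<^sup>2\<close> and \<open>x\<^sup>2\<close>, so both are empty.\<close>

lemma sum_triples_nonsquare:
  assumes "\<nexists>s. M = s\<^sup>2"
  shows "(\<Sum>(i, d, e)\<in>triples 4 M. d * (M - 5 * i\<^sup>2)) = 0"
proof -
  have e: "{(x, y, z)\<in>lorentz M. x = z \<and> x > 0 \<and> y > z} = {}"
    "{(x, y, z)\<in>lorentz M. x > \<bar>z\<bar> \<and> y = z} = {}"
    using assms by (auto simp: lorentz_def)
  show ?thesis unfolding sum_lorentz_boundary e by simp
qed

lemma sum_triples_square:
  assumes "s > 0"
  shows "3 * (\<Sum>(i, d, e)\<in>triples 4 (s\<^sup>2). d * (s\<^sup>2 - 5 * i\<^sup>2)) = s\<^sup>2 * (s\<^sup>2 - 1)"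
proof -
  have "(\<Sum>(x, y, z)\<in>{(x, y, z)\<in>lorentz (s\<^sup>2). x = z \<and> x > 0 \<and> y > z}. x * y * z)
      = (\<Sum>u\<in>{1..s - 1}. s * u\<^sup>2)"
    using assms
    \<comment> \<open>On this face \<open>y\<^sup>2 = s\<^sup>2\<close>, and
      \<open>y > z > 0\<close> selects \<open>y = s\<close>, leaving \<open>z\<close> free between 1
      and \<open>s - 1\<close>.\<close>
    by (intro sum.reindex_bij_witness[of _ "\<lambda>t. (t, s, t)" fst])
       (auto simp: lorentz_def power2_eq_iff, simp_all add: power2_eq_square)
  moreover have "(\<Sum>(x, y, z)\<in>{(x, y, z)\<in>lorentz (s\<^sup>2). x > \<bar>z\<bar> \<and> y = z}. x * y * z)
      = (\<Sum>u\<in>{1..s - 1}. s * (2 * u - s)\<^sup>2)"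
  proof (rule sum.reindex_cong)
    \<comment> \<open>Here \<open>x = s\<close>, and \<open>z\<close> has the parity of
      \<open>s\<close> with \<open>\<bar>z\<bar> < s\<close>; hence \<open>z = 2 * u - s\<close>
      with \<open>u\<close> from 1 to \<open>s - 1\<close>.\<close>
    show "inj_on (\<lambda>u. (s, 2 * u - s, 2 * u - s)) {1..s - 1}" by (auto simp: inj_on_def)
    show "{(x, y, z)\<in>lorentz (s\<^sup>2). x > \<bar>z\<bar> \<and> y = z} =
        (\<lambda>u. (s, 2 * u - s, 2 * u - s)) ` {1..s - 1}" (is "?L = ?R")
    proof (intro equalityI subsetI)
      fix t assume "t \<in> ?L"
      then obtain z where z: "t = (s, z, z)" "\<bar>z\<bar> < s" "even (s + z)"
        using assms by (auto simp: lorentz_def power2_eq_iff)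
      then obtain u where "s + z = 2 * u" by blast
      with z show "t \<in> ?R" by (intro image_eqI[of _ _ u]) auto
    qed (auto simp: lorentz_def)
  qed (simp add: power2_eq_square)
  ultimately have G: "(\<Sum>(i, d, e)\<in>triples 4 (s\<^sup>2). d * (s\<^sup>2 - 5 * i\<^sup>2))
      = 2 * (\<Sum>u\<in>{1..s - 1}. s * u\<^sup>2) - (\<Sum>u\<in>{1..s - 1}. s * (2 * u - s)\<^sup>2)"
    unfolding sum_lorentz_boundary by simp
  also have "\<dots> = (\<Sum>u\<in>{1..s - 1}. 4 * s\<^sup>2 * u - 2 * s * u\<^sup>2 - s ^ 3)"
    by (simp add: sum_distrib_left sum_subtractf[symmetric])
       (intro sum.cong refl, simp add: algebra_simps power2_eq_square power3_eq_cube)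
  also have "\<dots> = 4 * s\<^sup>2 * \<Sum>{1..s - 1} - 2 * s * (\<Sum>u\<in>{1..s - 1}. u\<^sup>2) - (s - 1) * s ^ 3"
    using assms by (simp add: sum_distrib_left sum_subtractf)
  finally have "3 * (\<Sum>(i, d, e)\<in>triples 4 (s\<^sup>2). d * (s\<^sup>2 - 5 * i\<^sup>2)) =
      6 * s\<^sup>2 * (2 * \<Sum>{1..s - 1}) - s * (6 * (\<Sum>u\<in>{1..s - 1}. u\<^sup>2)) - 3 * (s - 1) * s ^ 3"
    by simp
  moreover have "2 * \<Sum>{1..s - 1} = (s - 1) * s"
    "6 * (\<Sum>u\<in>{1..s - 1}. u\<^sup>2) = (s - 1) * s * (2 * s - 1)"
    using sum_int_atLeastAtMost[of "nat (s - 1)"] assms by simp_all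
  ultimately show ?thesis
    by (simp only:) (simp add: algebra_simps power2_eq_square power3_eq_cube)
qed

section \<open>Divisor sums and the recurrence for Jacobi's formula\<close>

text \<open>For \<open>c, m > 0\<close>, \<open>divsum c m\<close> is \<open>\<sigma>(m/c)\<close>, with value \<open>0\<close> unless \<open>c\<close> divides \<open>m\<close>.\<close>

definition divsum :: "int \<Rightarrow> int \<Rightarrow> int" where
  "divsum c m = (\<Sum>(d, e)\<in>{(d, e). d > 0 \<and> e > 0 \<and> c * d * e = m}. d)"

text \<open>The candidate for the four-square counting function on all integers: the first term
  supplies the value 1 at 0, where the divisor sums vanish, and negative arguments give 0.\<close>

definition jacobi :: "int \<Rightarrow> int" where
  "jacobi m = of_bool (m = 0) + 8 * divsum 1 m - 32 * divsum 4 m"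

lemma divsum_nonpos: "m \<le> 0 \<Longrightarrow> c > 0 \<Longrightarrow> divsum c m = 0"
proof -
  assume a: "m \<le> 0" "c > 0"
  then have e: "{(d, e). d > 0 \<and> e > 0 \<and> c * d * e = m} = {}"
    by (auto simp: zero_less_mult_iff simp flip: not_less)
  show ?thesis unfolding divsum_def e by simp
qed

text \<open>The solutions are sliced by their first coordinate; the range of \<open>k\<close> loses
  none of them because \<open>\<bar>i\<bar> \<le> i\<^sup>2 \<le> n\<close>.\<close>

lemma sum_divsum:
  assumes "c > 0"
  shows "(\<Sum>k\<in>{-n..n}. (n - 5 * k\<^sup>2) * divsum c (n - k\<^sup>2)) =
    (\<Sum>(i, d, e)\<in>triples c n. d * (n - 5 * i\<^sup>2))"
proof -
  have e: "triples c n = Sigma {-n..n} (\<lambda>k. {(d, e). d > 0 \<and> e > 0 \<and> c * d * e = n - k\<^sup>2})"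
  proof (rule Set.set_eqI)
    fix t
    show "t \<in> triples c n \<longleftrightarrow> t \<in> Sigma {-n..n} (\<lambda>k. {(d, e). d > 0 \<and> e > 0 \<and> c * d * e = n - k\<^sup>2})"
      using triples_bounds(1)[of "fst t" "fst (snd t)" "snd (snd t)" c n] assms
      by (auto simp: triples_def)
  qed
  have fin: "finite {(d, e). d > 0 \<and> e > 0 \<and> c * d * e = n - k\<^sup>2}" for k
  proof (rule finite_subset)
    show "{(d, e). d > 0 \<and> e > 0 \<and> c * d * e = n - k\<^sup>2} \<subseteq> snd ` triples c n"
      by (force simp: triples_def image_iff)
  qed (simp add: finite_triples assms)
  show ?thesis
    unfolding e
    by (subst sum.Sigma[symmetric])
       (use fin in \<open>auto simp: divsum_def sum_distrib_left case_prod_unfold ac_simps\<close>)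
qed

text \<open>In \<open>i\<^sup>2 + 4 * d * e = 4 * n\<close> the number \<open>i\<close> is even, and
  halving it gives the equation with \<open>c = 1\<close>. Thus both divisor sums reduce to the case
  \<open>c = 4\<close>.\<close>

lemma sum_triples_1:
  "(\<Sum>(i, d, e)\<in>triples 4 (4 * n). d * (4 * n - 5 * i\<^sup>2)) =
   4 * (\<Sum>(i, d, e)\<in>triples 1 n. d * (n - 5 * i\<^sup>2))"
proof -
  have ev: "\<exists>j. i = 2 * j \<and> (j, d, e) \<in> triples 1 n" if "(i, d, e) \<in> triples 4 (4 * n)" for i d e
  proof -
    have "i\<^sup>2 = 2 * (2 * n - 2 * d * e)" using that by (simp add: triples_def)
    then have "even (i\<^sup>2)" by (metis dvd_triv_left)
    then obtain j where "i = 2 * j" by auto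
    with that show ?thesis by (auto simp: triples_def power_mult_distrib)
  qed
  have od: "(2 * j, d, e) \<in> triples 4 (4 * n)" if "(j, d, e) \<in> triples 1 n" for j d e
    using that by (auto simp: triples_def power_mult_distrib)
  show ?thesis
    unfolding sum_distrib_left
    by (rule sum.reindex_bij_witness[of _ "\<lambda>(i, d, e). (2 * i, d, e)" "\<lambda>(i, d, e). (i div 2, d, e)"])
       (auto intro: od dest!: ev simp: power_mult_distrib)
qed

lemma jacobi_recurrence:
  assumes "n > 0"
  shows "(\<Sum>k\<in>{-n..n}. (n - 5 * k\<^sup>2) * jacobi (n - k\<^sup>2)) = 0"
proof -
  let ?G = "\<lambda>M. \<Sum>(i, d, e)\<in>triples 4 M. d * (M - 5 * i\<^sup>2)"
  let ?Z = "\<Sum>k\<in>{-n..n}. (n - 5 * k\<^sup>2) * of_bool (n - k\<^sup>2 = 0)"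
  have "(\<Sum>k\<in>{-n..n}. (n - 5 * k\<^sup>2) * jacobi (n - k\<^sup>2)) =
     ?Z + 8 * (\<Sum>k\<in>{-n..n}. (n - 5 * k\<^sup>2) * divsum 1 (n - k\<^sup>2))
     - 32 * (\<Sum>k\<in>{-n..n}. (n - 5 * k\<^sup>2) * divsum 4 (n - k\<^sup>2))"
    unfolding sum_distrib_left sum.distrib[symmetric] sum_subtractf[symmetric]
    by (intro sum.cong refl) (simp add: jacobi_def algebra_simps)
  also have "\<dots> = ?Z + 2 * ?G (4 * n) - 32 * ?G n"
    by (simp only: sum_divsum zero_less_numeral zero_less_one sum_triples_1)
  finally have eq: "(\<Sum>k\<in>{-n..n}. (n - 5 * k\<^sup>2) * jacobi (n - k\<^sup>2)) = ?Z + 2 * ?G (4 * n) - 32 * ?G n" .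
  show ?thesis
  proof (cases "\<exists>s. n = s\<^sup>2")
    case True
    then obtain s0 where "n = s0\<^sup>2" by blast
    then obtain s where s: "n = s\<^sup>2" "s > 0"
      using assms that[of "\<bar>s0\<bar>"] by auto
    \<comment> \<open>Only \<open>k = s\<close> and \<open>k = -s\<close> contribute, each with
      \<open>n - 5 * n\<close>. The resulting \<open>-8 * n\<close> offsets the boundary terms of
      \<open>?G (4 * n)\<close> and \<open>?G n\<close>.\<close>
    have "?Z = (\<Sum>k\<in>{s, -s}. (n - 5 * k\<^sup>2))"
      using s abs_le_square[of s]
      by (intro sum.mono_neutral_cong_right) (auto simp: power2_eq_iff)
    also have "\<dots> = -8 * n" using s by simp
    finally have "?Z = -8 * n" .
    moreover have "3 * ?G n = n * n - n"
      using sum_triples_square[of s] s by (simp add: right_diff_distrib)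
    moreover have "3 * ?G (4 * n) = 16 * (n * n) - 4 * n"
      using sum_triples_square[of "2 * s"] s by (simp add: power_mult_distrib right_diff_distrib)
    ultimately show ?thesis using eq by linarith
  next
    case False
    have "\<nexists>s. 4 * n = s\<^sup>2"
    proof
      assume "\<exists>s. 4 * n = s\<^sup>2"
      then obtain s where s: "4 * n = s\<^sup>2" by blast
      then have "even (s\<^sup>2)" by (metis dvd_mult2 even_numeral)
      then have "even s" by simp
      then obtain t where "s = 2 * t" by blast
      with s have "n = t\<^sup>2" by (simp add: power_mult_distrib)
      with False show False by blast
    qed
    moreover have "?Z = 0"
      using False by (intro sum.neutral) auto
    ultimately show ?thesis using eq False by (simp add: sum_triples_nonsquare)
  qed
qed

section \<open>Jacobi's four-square theorem\<close>

definition quads :: "int \<Rightarrow> (int \<times> int \<times> int \<times> int) set" where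
  "quads m = {(a, b, c, d). a\<^sup>2 + b\<^sup>2 + c\<^sup>2 + d\<^sup>2 = m}"

lemma quads_bounds:
  assumes "(a, b, c, d) \<in> quads m"
  shows "a \<in> {-m..m}" "b \<in> {-m..m}" "c \<in> {-m..m}" "d \<in> {-m..m}" "m \<ge> 0"
proof -
  have "\<bar>a\<bar> \<le> m" "\<bar>b\<bar> \<le> m" "\<bar>c\<bar> \<le> m" "\<bar>d\<bar> \<le> m"
    using assms abs_le_square[of a] abs_le_square[of b] abs_le_square[of c] abs_le_square[of d]
    by (auto simp: quads_def)
  then show "a \<in> {-m..m}" "b \<in> {-m..m}" "c \<in> {-m..m}" "d \<in> {-m..m}" "m \<ge> 0"
    by (auto simp: abs_le_iff)
qed

lemma finite_quads: "finite (quads m)"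
proof (rule finite_subset)
  show "quads m \<subseteq> {-m..m} \<times> {-m..m} \<times> {-m..m} \<times> {-m..m}"
    using quads_bounds by fast
qed simp

lemma card_quads_recurrence:
  "(\<Sum>k\<in>{-n..n}. (n - 5 * k\<^sup>2) * int (card (quads (n - k\<^sup>2)))) = 0"
proof -
  let ?Q = "{(k, a, b, c, d). k\<^sup>2 + a\<^sup>2 + b\<^sup>2 + c\<^sup>2 + d\<^sup>2 = n}"
  let ?S = "\<lambda>f. \<Sum>(k, a, b, c, d)\<in>?Q. f k a b c d :: int"
  have e: "?Q = Sigma {-n..n} (\<lambda>k. quads (n - k\<^sup>2))"
  proof (rule Set.set_eqI, clarify)
    fix k a b c d
    show "(k, a, b, c, d) \<in> ?Q \<longleftrightarrow> (k, a, b, c, d) \<in> Sigma {-n..n} (\<lambda>k. quads (n - k\<^sup>2))"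
    proof -
      have "k \<in> {-n..n}" if "k\<^sup>2 + a\<^sup>2 + b\<^sup>2 + c\<^sup>2 + d\<^sup>2 = n"
      proof -
        have "\<bar>k\<bar> \<le> n"
          using that abs_le_square[of k] zero_le_power2[of a] zero_le_power2[of b]
            zero_le_power2[of c] zero_le_power2[of d] by linarith
        then show ?thesis by (auto simp: abs_le_iff)
      qed
      then show ?thesis by (auto simp: quads_def)
    qed
  qed
  have "?S (\<lambda>k a b c d. a\<^sup>2) = ?S (\<lambda>k a b c d. k\<^sup>2)"
    by (rule sum.reindex_bij_witness[of _ "\<lambda>(k, a, b, c, d). (a, k, b, c, d)" "\<lambda>(k, a, b, c, d). (a, k, b, c, d)"]) auto
  moreover have "?S (\<lambda>k a b c d. b\<^sup>2) = ?S (\<lambda>k a b c d. k\<^sup>2)"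
    by (rule sum.reindex_bij_witness[of _ "\<lambda>(k, a, b, c, d). (b, a, k, c, d)" "\<lambda>(k, a, b, c, d). (b, a, k, c, d)"]) auto
  moreover have "?S (\<lambda>k a b c d. c\<^sup>2) = ?S (\<lambda>k a b c d. k\<^sup>2)"
    by (rule sum.reindex_bij_witness[of _ "\<lambda>(k, a, b, c, d). (c, a, b, k, d)" "\<lambda>(k, a, b, c, d). (c, a, b, k, d)"]) auto
  moreover have "?S (\<lambda>k a b c d. d\<^sup>2) = ?S (\<lambda>k a b c d. k\<^sup>2)"
    by (rule sum.reindex_bij_witness[of _ "\<lambda>(k, a, b, c, d). (d, a, b, c, k)" "\<lambda>(k, a, b, c, d). (d, a, b, c, k)"]) auto
  \<comment> \<open>Substituting the sum of the five squares for \<open>n\<close> leaves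
    \<open>a\<^sup>2 + b\<^sup>2 + c\<^sup>2 + d\<^sup>2 - 4 * k\<^sup>2\<close>, whose sum vanishes
    by the four exchanges with \<open>k\<close> above.\<close>
  moreover have "?S (\<lambda>k a b c d. n - 5 * k\<^sup>2) = ?S (\<lambda>k a b c d. a\<^sup>2) + ?S (\<lambda>k a b c d. b\<^sup>2)
     + ?S (\<lambda>k a b c d. c\<^sup>2) + ?S (\<lambda>k a b c d. d\<^sup>2) - 4 * ?S (\<lambda>k a b c d. k\<^sup>2)"
    unfolding sum_distrib_left sum.distrib[symmetric] sum_subtractf[symmetric]
    by (intro sum.cong refl) auto
  ultimately have "?S (\<lambda>k a b c d. n - 5 * k\<^sup>2) = 0" by linarith
  also have "?S (\<lambda>k a b c d. n - 5 * k\<^sup>2) = (\<Sum>k\<in>{-n..n}. \<Sum>q\<in>quads (n - k\<^sup>2). n - 5 * k\<^sup>2)"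
    unfolding e by (subst sum.Sigma) (auto simp: finite_quads case_prod_unfold)
  finally show ?thesis by (simp add: ac_simps)
qed

theorem four_squares: "int (card (quads (int n))) = jacobi (int n)"
proof (induction n rule: less_induct)
  case (less n)
  show ?case
  proof (cases "n = 0")
    case True
    have "quads 0 = {(0, 0, 0, 0)}"
    proof (intro equalityI subsetI)
      fix t assume "t \<in> quads 0"
      moreover obtain a b c d where "t = (a, b, c, d)" by (cases t) auto
      ultimately show "t \<in> {(0, 0, 0, 0)}"
        using quads_bounds[of a b c d 0] by auto
    qed (simp add: quads_def)
    then show ?thesis using True by (simp add: jacobi_def divsum_nonpos)
  next
    case False
    define m where "m = int n"
    have m: "m > 0" using False by (simp add: m_def)
    have eq: "int (card (quads (m - k\<^sup>2))) = jacobi (m - k\<^sup>2)" if "k \<noteq> 0" for k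
    proof (cases "m - k\<^sup>2 < 0")
      case True
      then have "quads (m - k\<^sup>2) = {}" using quads_bounds(5) by force
      then show ?thesis using True by (simp add: jacobi_def divsum_nonpos)
    next
      case False
      have "k\<^sup>2 > 0" using that by simp
      then have "nat (m - k\<^sup>2) < n" using False by (simp add: m_def nat_less_iff)
      from less.IH[OF this] show ?thesis using False by simp
    qed
    \<comment> \<open>The term \<open>k = 0\<close> isolates the value at \<open>m\<close> with the
      nonzero factor \<open>m\<close>; every other term has a smaller argument, already covered by
      \<open>eq\<close>.\<close>
    have split: "(\<Sum>k\<in>{-m..m}. (m - 5 * k\<^sup>2) * f (m - k\<^sup>2)) =
        m * f m + (\<Sum>k\<in>{-m..m} - {0}. (m - 5 * k\<^sup>2) * f (m - k\<^sup>2))" for f :: "int \<Rightarrow> int"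
      using m by (subst sum.remove[of _ 0]) auto
      have "(\<Sum>k\<in>{-m..m} - {0}. (m - 5 * k\<^sup>2) * int (card (quads (m - k\<^sup>2)))) =
        (\<Sum>k\<in>{-m..m} - {0}. (m - 5 * k\<^sup>2) * jacobi (m - k\<^sup>2))"
      by (intro sum.cong refl) (auto simp: eq)
    then have "m * int (card (quads m)) = m * jacobi m"
      using split[of "\<lambda>m. int (card (quads m))"] split[of jacobi]
        jacobi_recurrence[OF m] card_quads_recurrence[of m] by linarith
    then show ?thesis using m by (simp add: m_def)
  qed
qed

section \<open>Divisor sums and \<open>W\<close> at rational arguments\<close>

lemma of_nat_divide_in_Ints_iff:
  assumes "c > 0"
  shows "(of_nat n / of_nat c :: rat) \<in> \<int> \<longleftrightarrow> c dvd n"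
proof
  assume "(of_nat n / of_nat c :: rat) \<in> \<int>"
  then obtain z where "of_nat n / of_nat c = (of_int z :: rat)" by (auto elim: Ints_cases)
  with assms have "of_int (int n) = (of_int (int c * z) :: rat)" by (simp add: field_simps)
  then have "int n = int c * z" by (simp only: of_int_eq_iff)
  then show "c dvd n" by (metis dvd_triv_left int_dvd_int_iff)
next
  assume "c dvd n"
  then show "(of_nat n / of_nat c :: rat) \<in> \<int>" using assms by auto
qed

lemma divsum_mult_cancel: "c > 0 \<Longrightarrow> divsum (c * p) (c * m) = divsum p m"
  by (simp add: divsum_def mult.assoc)

lemma divsum_not_dvd:
  assumes "\<not> c dvd m"
  shows "divsum c m = 0"
proof -
  have e: "{(d, e). d > 0 \<and> e > 0 \<and> c * d * e = m} = {}"
    using assms by auto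
  show ?thesis unfolding divsum_def e by simp
qed

lemma divsum_1_eq_sigma: "divsum 1 (int n) = sigma (of_nat n)"
proof (cases "n = 0")
  case True
  then show ?thesis by (simp add: divsum_nonpos sigma_def)
next
  case False
  have "divsum 1 (int n) = (\<Sum>d\<in>{d. d dvd n}. int d)"
    unfolding divsum_def
    by (rule sum.reindex_bij_witness[of _ "\<lambda>d. (int d, int (n div d))" "\<lambda>(d, e). nat d"])
       (use False in \<open>auto elim!: dvdE dest!: zero_less_imp_eq_int simp flip: of_nat_mult\<close>)
  then show ?thesis using False by (simp add: sigma_def sigma_k_def)
qed

text \<open>If \<open>c\<close> does not divide \<open>n\<close>, the left side is an empty sum and
  the right side takes the default value 0 of \<open>sigma\<close> at a non-integer.\<close>

lemma divsum_eq_sigma: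
  assumes "c > 0"
  shows "divsum (int c) (int n) = sigma (of_nat n / of_nat c)"
proof (cases "c dvd n")
  case True
  then obtain k where k: "n = c * k" by blast
  show ?thesis
    using assms divsum_mult_cancel[of "int c" 1 "int k"] by (simp add: k divsum_1_eq_sigma)
next
  case False
  then show ?thesis
    using assms by (simp add: divsum_not_dvd sigma_def of_nat_divide_in_Ints_iff)
qed

text \<open>Clearing the denominator moves \<open>c\<close> into the coefficients; if
  \<open>c\<close> does not divide \<open>n\<close>, the cleared equation has no solution, in
  agreement with the default value of \<open>W\<close>.\<close>

lemma W_divide:
  assumes "c > 0" "n > 0"
  shows "W a b (of_nat n / of_nat c) =
    (\<Sum>(l, m)\<in>{(l, m). c * a * l + c * b * m = n}. sigma (of_nat l) * sigma (of_nat m))"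
proof (cases "c dvd n")
  case True
  then obtain k where k: "n = c * k" by blast
  have "{(l, m). c * a * l + c * b * m = n} = {p. a * fst p + b * snd p = k}"
    using assms by (auto simp: k mult.assoc simp flip: distrib_left)
  then show ?thesis using assms by (simp add: k W_def)
next
  case False
  then have e: "{(l, m). c * a * l + c * b * m = n} = {}"
    by (auto simp: mult.assoc simp flip: distrib_left)
  show ?thesis
    unfolding e using False assms by (simp add: W_def of_nat_divide_in_Ints_iff)
qed

lemma finite_linear_eq:
  assumes "a > 0" "b > 0"
  shows "finite {(l, m). a * l + b * m = (n :: nat)}"
proof (rule finite_subset)
  show "{(l, m). a * l + b * m = n} \<subseteq> {..n} \<times> {..n}"
  proof
    fix t assume "t \<in> {(l, m). a * l + b * m = n}"
    then obtain l m where "t = (l, m)" "a * l + b * m = n" by blast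
    moreover have "l \<le> a * l" "m \<le> b * m" using assms by simp_all
    ultimately show "t \<in> {..n} \<times> {..n}"
      by (auto intro: trans_le_add1 trans_le_add2)
  qed
qed simp

section \<open>Reduction of \<open>N\<close> to convolutions of divisor sums\<close>

lemma sum_squares_blocks:
  fixes x :: "nat \<Rightarrow> int"
  shows "(\<Sum>i<4. (x i)\<^sup>2) = (x 0)\<^sup>2 + (x 1)\<^sup>2 + (x 2)\<^sup>2 + (x 3)\<^sup>2"
    and "(\<Sum>i\<in>{4..<8}. (x i)\<^sup>2) = (x 4)\<^sup>2 + (x 5)\<^sup>2 + (x 6)\<^sup>2 + (x 7)\<^sup>2"
  by (simp_all add: eval_nat_numeral)

lemma N_convolution:
  assumes "a > 0" "b > 0"
  shows "int (N a b n) = (\<Sum>(l, m)\<in>{(l, m). a * l + b * m = n}. jacobi (int l) * jacobi (int m))"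
proof -
  let ?X = "{x :: nat \<Rightarrow> int. (\<forall>i \<ge> 8. x i = 0) \<and>
     int n = int a * (\<Sum>i<4. (x i)\<^sup>2) + int b * (\<Sum>i\<in>{4..<8}. (x i)\<^sup>2)}"
  let ?P = "{(l, m). a * l + b * m = n}"
  let ?Y = "Sigma ?P (\<lambda>(l, m). quads (int l) \<times> quads (int m))"
  let ?f = "\<lambda>x. ((nat (\<Sum>i<4. (x i)\<^sup>2), nat (\<Sum>i\<in>{4..<8}. (x i)\<^sup>2)),
     ((x 0, x 1, x 2, x 3), (x 4, x 5, x 6, x 7)))"
  \<comment> \<open>The inverse glues the two quadruples together and pads with zeros from index 8
    on. It may ignore the recorded pair \<open>(l, m)\<close>, which the quadruples
    determine.\<close>
  let ?g = "\<lambda>(_, ((p, q, r, s), (t, u, v, w))) i. if i < 8 then [p, q, r, s, t, u, v, w] ! i else 0"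
  have "bij_betw ?f ?X ?Y"
  proof (rule bij_betw_byWitness[where f' = ?g])
    show "\<forall>x\<in>?X. ?g (?f x) = x"
    proof
      fix x assume x: "x \<in> ?X"
      show "?g (?f x) = x"
      proof
        fix i :: nat
        consider "i = 0" | "i = 1" | "i = 2" | "i = 3" | "i = 4" | "i = 5" | "i = 6" | "i = 7" | "i \<ge> 8"
          by linarith
        then show "?g (?f x) i = x i" by cases (use x in auto)
      qed
    qed
    show "\<forall>y\<in>?Y. ?f (?g y) = y"
      by (auto simp: sum_squares_blocks quads_def)
    show "?f ` ?X \<subseteq> ?Y"
    proof (rule image_subsetI)
      fix x assume "x \<in> ?X"
      then have "int n = int a * (\<Sum>i<4. (x i)\<^sup>2) + int b * (\<Sum>i\<in>{4..<8}. (x i)\<^sup>2)" by simp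
      moreover have "(\<Sum>i<4. (x i)\<^sup>2) \<ge> 0" "(\<Sum>i\<in>{4..<8}. (x i)\<^sup>2) \<ge> 0" by (auto intro: sum_nonneg)
      ultimately have "int (a * nat (\<Sum>i<4. (x i)\<^sup>2) + b * nat (\<Sum>i\<in>{4..<8}. (x i)\<^sup>2)) = int n"
        by simp
      then have "a * nat (\<Sum>i<4. (x i)\<^sup>2) + b * nat (\<Sum>i\<in>{4..<8}. (x i)\<^sup>2) = n"
        by (simp only: of_nat_eq_iff)
      then show "?f x \<in> ?Y"
        by (simp add: sum_squares_blocks quads_def)
    qed
    show "?g ` ?Y \<subseteq> ?X"
      by (auto simp: sum_squares_blocks quads_def)
  qed
  then have "N a b n = card ?Y"
    unfolding N_def by (rule bij_betw_same_card)
  also have "\<dots> = (\<Sum>(l, m)\<in>?P. card (quads (int l)) * card (quads (int m)))"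
    using finite_linear_eq[OF assms]
    by (subst card_SigmaI) (auto simp: finite_quads case_prod_unfold)
  finally show ?thesis by (simp add: case_prod_unfold four_squares)
qed

text \<open>Only multiples of \<open>p\<close> and \<open>q\<close> contribute, so \<open>l\<close>
  and \<open>m\<close> can be replaced by \<open>p * l\<close> and \<open>q * m\<close>. This puts
  the convolution into the shape of \<open>W\<close>.\<close>

lemma sum_divsum_divsum:
  assumes "p > 0" "q > 0" "a > 0" "b > 0"
  shows "(\<Sum>(l, m)\<in>{(l, m). a * l + b * m = n}. divsum (int p) (int l) * divsum (int q) (int m)) =
    (\<Sum>(l, m)\<in>{(l, m). p * a * l + q * b * m = n}. sigma (of_nat l) * sigma (of_nat m))"
proof -
  have dvd: "c dvd k" if "divsum (int c) (int k) \<noteq> 0" for c k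
    using that divsum_not_dvd[of "int c" "int k"] by auto
  have "(\<Sum>(l, m)\<in>{(l, m). a * l + b * m = n}. divsum (int p) (int l) * divsum (int q) (int m)) =
    (\<Sum>(l, m)\<in>{(l, m). a * l + b * m = n \<and> p dvd l \<and> q dvd m}.
      divsum (int p) (int l) * divsum (int q) (int m))"
    by (intro sum.mono_neutral_right)
       (use finite_linear_eq[OF assms(3,4)] in \<open>auto dest: dvd\<close>)
  also have "\<dots> = (\<Sum>(l, m)\<in>{(l, m). p * a * l + q * b * m = n}. sigma (of_nat l) * sigma (of_nat m))"
    by (rule sum.reindex_bij_witness[of _ "\<lambda>(l, m). (p * l, q * m)" "\<lambda>(l, m). (l div p, m div q)"])
       (use assms in \<open>auto simp: divsum_eq_sigma ac_simps elim!: dvdE\<close>)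
  finally show ?thesis .
qed

text \<open>The only possible contribution is at \<open>l = 0\<close>, \<open>m = n / b\<close>; if
  \<open>b\<close> does not divide \<open>n\<close>, both sides are 0.\<close>

lemma sum_divsum_zero_left:
  assumes "b > 0"
  shows "(\<Sum>(l, m)\<in>{(l, m). l + b * m = n}. of_bool (l = 0) * divsum (int q) (int m)) =
    divsum (int (b * q)) (int n)"
proof (cases "b dvd n")
  case True
  then obtain k where k: "n = b * k" by blast
  have "(\<Sum>(l, m)\<in>{(l, m). l + b * m = n}. of_bool (l = 0) * divsum (int q) (int m)) =
     (\<Sum>(l, m)\<in>{(0 :: nat, k)}. of_bool (l = 0) * divsum (int q) (int m))"
    by (intro sum.mono_neutral_right) (use finite_linear_eq[of 1 b n] assms in \<open>auto simp: k\<close>)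
  also have "\<dots> = divsum (int (b * q)) (int n)"
    using assms by (simp add: k divsum_mult_cancel)
  finally show ?thesis .
next
  case False
  then have "\<not> int (b * q) dvd int n" by (auto dest: dvd_mult_left simp del: of_nat_mult)
  then have "divsum (int (b * q)) (int n) = 0" by (rule divsum_not_dvd)
  then show ?thesis using False by (auto intro!: sum.neutral gr0I)
qed

lemma sum_divsum_zero_right:
  assumes "b > 0"
  shows "(\<Sum>(l, m)\<in>{(l, m). l + b * m = n}. divsum p (int l) * of_bool (m = 0)) = divsum p (int n)"
proof -
  have "(\<Sum>(l, m)\<in>{(l, m). l + b * m = n}. divsum p (int l) * of_bool (m = 0)) =
     (\<Sum>(l, m)\<in>{(n, 0 :: nat)}. divsum p (int l) * of_bool (m = 0))"
    by (intro sum.mono_neutral_right) (use finite_linear_eq[of 1 b n] assms in auto)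
  then show ?thesis by simp
qed

theorem theorem4p1:
  fixes n :: nat
  assumes "n \<ge> 1"
  shows "int (N 1 3 n) =
      8 * sigma (of_nat n) - 32 * sigma (of_nat n / 4) + 8 * sigma (of_nat n / 3)
    - 32 * sigma (of_nat n / 12) + 64 * W 1 3 (of_nat n) + 1024 * W 1 3 (of_nat n / 4)
    - 256 * (W 3 4 (of_nat n) + W 1 12 (of_nat n))"
proof -
  define S :: "(nat \<Rightarrow> nat \<Rightarrow> int) \<Rightarrow> int"
    where "S f = (\<Sum>(l, m)\<in>{(l, m). l + 3 * m = n}. f l m)" for f
  let ?D = "\<lambda>p l. divsum (int p) (int l)"
  have "int (N 1 3 n) = S (\<lambda>l m. jacobi (int l) * jacobi (int m))"
    using N_convolution[of 1 3 n] by (simp add: S_def)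
  also have "\<dots> = S (\<lambda>l m. 8 * (?D 1 l * of_bool (m = 0)) - 32 * (?D 4 l * of_bool (m = 0))
      + 8 * (of_bool (l = 0) * ?D 1 m) - 32 * (of_bool (l = 0) * ?D 4 m)
      + 64 * (?D 1 l * ?D 1 m) + 1024 * (?D 4 l * ?D 4 m)
      - 256 * (?D 4 l * ?D 1 m) - 256 * (?D 1 l * ?D 4 m))"
    \<comment> \<open>The product of the two indicator terms is absent from the expansion:
      \<open>l = m = 0\<close> would force \<open>n = 0\<close>.\<close>
    unfolding S_def using assms
    by (intro sum.cong refl) (auto simp: jacobi_def algebra_simps)
  also have "\<dots> = 8 * S (\<lambda>l m. ?D 1 l * of_bool (m = 0)) - 32 * S (\<lambda>l m. ?D 4 l * of_bool (m = 0))
      + 8 * S (\<lambda>l m. of_bool (l = 0) * ?D 1 m) - 32 * S (\<lambda>l m. of_bool (l = 0) * ?D 4 m)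
      + 64 * S (\<lambda>l m. ?D 1 l * ?D 1 m) + 1024 * S (\<lambda>l m. ?D 4 l * ?D 4 m)
      - 256 * S (\<lambda>l m. ?D 4 l * ?D 1 m) - 256 * S (\<lambda>l m. ?D 1 l * ?D 4 m)"
    by (simp only: S_def case_prod_unfold sum.distrib sum_subtractf sum_distrib_left)
  also have "S (\<lambda>l m. ?D 1 l * of_bool (m = 0)) = sigma (of_nat n)"
    using sum_divsum_zero_right[of 3 1 n] divsum_eq_sigma[of 1 n] by (simp add: S_def)
  also have "S (\<lambda>l m. ?D 4 l * of_bool (m = 0)) = sigma (of_nat n / 4)"
    using sum_divsum_zero_right[of 3 4 n] divsum_eq_sigma[of 4 n] by (simp add: S_def)
  also have "S (\<lambda>l m. of_bool (l = 0) * ?D 1 m) = sigma (of_nat n / 3)"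
    using sum_divsum_zero_left[of 3 1 n] divsum_eq_sigma[of 3 n] by (simp add: S_def)
  also have "S (\<lambda>l m. of_bool (l = 0) * ?D 4 m) = sigma (of_nat n / 12)"
    using sum_divsum_zero_left[of 3 4 n] divsum_eq_sigma[of 12 n] by (simp add: S_def)
  also have "S (\<lambda>l m. ?D 1 l * ?D 1 m) = W 1 3 (of_nat n)"
    using sum_divsum_divsum[of 1 1 1 3 n] W_divide[of 1 n 1 3] assms by (simp add: S_def)
  also have "S (\<lambda>l m. ?D 4 l * ?D 4 m) = W 1 3 (of_nat n / 4)"
    using sum_divsum_divsum[of 4 4 1 3 n] W_divide[of 4 n 1 3] assms by (simp add: S_def)
  also have "S (\<lambda>l m. ?D 1 l * ?D 4 m) = W 1 12 (of_nat n)"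
    using sum_divsum_divsum[of 1 4 1 3 n] W_divide[of 1 n 1 12] assms by (simp add: S_def)
  also have "S (\<lambda>l m. ?D 4 l * ?D 1 m) = W 3 4 (of_nat n)"
  proof -
    \<comment> \<open>The factor 4 falls on \<open>l\<close>, giving coefficients 4 and 3, whereas
      \<open>W 3 4\<close> has them in the opposite order.\<close>
    have "(\<Sum>(l, m)\<in>{(l, m). 4 * l + 3 * m = n}. sigma (of_nat l) * sigma (of_nat m)) =
      (\<Sum>(l, m)\<in>{(l, m). 3 * l + 4 * m = n}. sigma (of_nat l) * sigma (of_nat m))"
      by (rule sum.reindex_bij_witness[of _ prod.swap prod.swap]) auto
    then show ?thesis
      using sum_divsum_divsum[of 4 1 1 3 n] W_divide[of 1 n 3 4] assms by (simp add: S_def)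
  qed
  finally show ?thesis by simp
qed

end
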